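(* Let $\mathcal{A}(s)=sE-A$ with $E,A\in\mathbb{C}^{n\times n}$ be a regular matrix pencil. Then for any matrix pencil $\mathcal{P}(s)=sF-G$, $F,G\in\mathbb{C}^{n\times n}$, of rank one such that $(\mathcal{A}+\mathcal{P})(s)$ is regular, we have for all $\lambda\in\overline{\mathbb{C}}$ and all $k\in\mathbb{N}\setminus\{0\}$ $$\left|\dim\frac{\mathcal{L}_{\lambda}^{k+1}(\mathcal{A}+\mathcal{P})}{\mathcal{L}_{\lambda}^k(\mathcal{A}+\mathcal{P})}-\dim\frac{\mathcal{L}_{\lambda}^{k+1}(\mathcal{A})}{\mathcal{L}_{\lambda}^{k}(\mathcal{A})}\right|\leq 1,$$ $$\left|\dim \mathcal{L}_{\lambda}^k(\mathcal{A}+\mathcal{P})-\dim \mathcal{L}_{\lambda}^k(\mathcal{A})\right|\leq k.$$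
   Context: $\overline{\mathbb{C}}:=\mathbb{C}\cup\{\infty\}$. A matrix pencil is $\mathcal{A}(s)=sE-A$ with $E,A\in\mathbb{C}^{n\times n}$; sums of pencils are formed pointwise. It is regular if $\det(sE-A)$ is not the zero polynomial. The rank of a pencil is the largest $r$ such that, viewed as a matrix with polynomial entries, it has an $r\times r$ minor that is not the zero polynomial. Jordan chains: $\{g_0,\ldots,g_{m-1}\}\subset\mathbb{C}^n$ is a Jordan chain of length $m$ at $\lambda\in\mathbb{C}$ if $g_0\neq0$, $(A-\lambda E)g_0=0$ and $(A-\lambda E)g_j=Eg_{j-1}$ for $1\le j\le m-1$; it is a Jordan chain of length $m$ at $\infty$ if $g_0\neq0$, $Eg_0=0$ and $Eg_j=Ag_{j-1}$ for $1\le j\le m-1$. For $\lambda\in\overline{\mathbb{C}}$ and $l\in\mathbb{N}\setminus\{0\}$, $\mathcal{L}^l_\lambda(\mathcal{A})$ is the subspace of $\mathbb{C}^n$ consisting of the zero vector and all $g_j$, $0\le j\le l-1$, such that $\{g_0,\ldots,g_j\}$ is a Jordan chain of $\mathcal{A}(s)$ at $\lambda$ for some $g_0,\ldots,g_{j-1}$. *)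

theory Defs
  imports
    "HOL-Analysis.Analysis"
    "HOL-Library.Set_Algebras"
    "HOL-Computational_Algebra.Polynomial"
    "Jordan_Normal_Form.Missing_VectorSpace"
begin

text \<open>The pencil \<open>s E - A\<close> as a matrix with polynomial entries.\<close>

definition pencil :: "complex^'n^'n \<Rightarrow> complex^'n^'n \<Rightarrow> complex poly^'n^'n" where
  "pencil E A = (\<chi> i j. [:- (A $ i $ j), E $ i $ j:])"

lemma pencil_add: "pencil E A + pencil F G = pencil (E + F) (A + G)"
  by (simp add: pencil_def vec_eq_iff)

lemma poly_pencil: "poly (pencil E A $ i $ j) s = (mat s ** E - A) $ i $ j"
proof -
  have "(mat s ** E) $ i $ j = (\<Sum>k\<in>UNIV. if i = k then s * E $ k $ j else 0)"
    unfolding matrix_matrix_mult_def mat_def vec_lambda_beta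
    by (rule sum.cong) simp_all
  then show ?thesis
    by (simp add: pencil_def)
qed

definition regular_pencil :: "complex^'n^'n \<Rightarrow> complex^'n^'n \<Rightarrow> bool" where
  "regular_pencil E A \<longleftrightarrow> det (pencil E A) \<noteq> 0"

text \<open>
  Leibniz formula for the determinant of the \<open>r \<times> r\<close> matrix with entries
  \<open>M $ \<rho> i $ \<kappa> j\<close>. The index types carry no order, so \<open>\<rho>\<close> and \<open>\<kappa>\<close> will range over all
  injective (not just increasing) selections of rows and columns; this only affects the sign.
\<close>

definition minor ::
  "'a::comm_ring_1^'n^'m \<Rightarrow> nat \<Rightarrow> (nat \<Rightarrow> 'm) \<Rightarrow> (nat \<Rightarrow> 'n) \<Rightarrow> 'a" where
  "minor M r \<rho> \<kappa> =
    (\<Sum>p | p permutes {..<r}. of_int (sign p) * (\<Prod>i<r. M $ \<rho> i $ \<kappa> (p i)))"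

text \<open>The set below is finite and contains \<open>0\<close>, since the empty minor is \<open>1\<close>.\<close>

definition pencil_rank :: "complex^'n^'n \<Rightarrow> complex^'n^'n \<Rightarrow> nat" where
  "pencil_rank E A = Max {r. \<exists>\<rho> \<kappa>. inj_on \<rho> {..<r} \<and> inj_on \<kappa> {..<r} \<and>
                              minor (pencil E A) r \<rho> \<kappa> \<noteq> 0}"

datatype extended_complex = Finite complex | Infinity

text \<open>Only the values \<open>g 0, \<dots>, g (m - 1)\<close> matter.\<close>

fun jordan_chain ::
  "complex^'n^'n \<Rightarrow> complex^'n^'n \<Rightarrow> extended_complex \<Rightarrow> nat \<Rightarrow> (nat \<Rightarrow> complex^'n) \<Rightarrow> bool" where
  "jordan_chain E A (Finite l) m g \<longleftrightarrow>
     0 < m \<and> g 0 \<noteq> 0 \<and> (A - mat l ** E) *v g 0 = 0 \<and>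
     (\<forall>j. 1 \<le> j \<and> j < m \<longrightarrow> (A - mat l ** E) *v g j = E *v g (j - 1))"
| "jordan_chain E A Infinity m g \<longleftrightarrow>
     0 < m \<and> g 0 \<noteq> 0 \<and> E *v g 0 = 0 \<and>
     (\<forall>j. 1 \<le> j \<and> j < m \<longrightarrow> E *v g j = A *v g (j - 1))"

definition jordan_space ::
  "complex^'n^'n \<Rightarrow> complex^'n^'n \<Rightarrow> extended_complex \<Rightarrow> nat \<Rightarrow> (complex^'n) set" where
  "jordan_space E A \<mu> l = {0} \<union> {g j | g j. j < l \<and> jordan_chain E A \<mu> (j + 1) g}"

text \<open>
  For subspaces \<open>W \<subseteq> U\<close>, the vector space of cosets \<open>u + W\<close> with \<open>u \<in> U\<close>; sums of cosets are
  pointwise sums of sets. In the scalar multiplication, adding \<open>W\<close> matters only for the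
  scalar \<open>0\<close>, where the image alone would be \<open>{0}\<close>. The ring fields \<open>mult\<close> and \<open>one\<close> of the
  module record have no meaning here.
\<close>

definition quotient_space ::
  "('a::field^'n) set \<Rightarrow> ('a^'n) set \<Rightarrow> ('a, ('a^'n) set) module" where
  "quotient_space U W =
     \<lparr>carrier = (\<lambda>u. u +o W) ` U, mult = undefined, one = undefined, zero = W,
      add = (+), smult = (\<lambda>c X. (\<lambda>x. c *s x) ` X + W)\<rparr>"

definition field_ring :: "'a::field ring" where
  "field_ring = \<lparr>carrier = UNIV, mult = (*), one = 1, zero = 0, add = (+)\<rparr>"

lemma vectorspace_quotient_space:
  fixes U W :: "('a::field^'n) set"
  assumes U: "vec.subspace U" and W: "vec.subspace W" and "W \<subseteq> U"
  shows "vectorspace field_ring (quotient_space U W)"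
proof -
  have plus: "(u +o W) + (v +o W) = (u + v) +o W" for u v
  proof -
    have "W + W = W"
      using vec.subspace_add[OF W] vec.subspace_0[OF W]
      by (auto simp: set_plus_def) (metis add.right_neutral)
    then show ?thesis
      by (simp add: set_plus_rearrange)
  qed
  have smult: "(\<lambda>x. c *s x) ` (u +o W) + W = (c *s u) +o W" for c u
  proof -
    have "(\<lambda>x. c *s x) ` (u +o W) + W \<subseteq> (c *s u) +o W"
      using vec.subspace_add[OF W] vec.subspace_scale[OF W]
      by (force simp: elt_set_plus_def set_plus_def vec.scale_right_distrib add.assoc)
    moreover have "(c *s u) +o W \<subseteq> (\<lambda>x. c *s x) ` (u +o W) + W"
    proof
      fix x assume "x \<in> (c *s u) +o W"
      then obtain w where "w \<in> W" "x = c *s u + w"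
        by (auto simp: elt_set_plus_def)
      moreover have "u \<in> u +o W"
        using vec.subspace_0[OF W] by (force simp: elt_set_plus_def)
      ultimately show "x \<in> (\<lambda>x. c *s x) ` (u +o W) + W"
        by (auto simp: set_plus_def)
    qed
    ultimately show ?thesis by blast
  qed
  have carr: "X \<in> carrier (quotient_space U W) \<longleftrightarrow> (\<exists>u\<in>U. X = u +o W)" for X
    by (auto simp: quotient_space_def)
  have ops: "add (quotient_space U W) (u +o W) (v +o W) = (u + v) +o W"
    "smult (quotient_space U W) c (u +o W) = (c *s u) +o W"
    "zero (quotient_space U W) = 0 +o W" for u v c
    using plus smult by (simp_all add: quotient_space_def)
  have W_carr: "\<exists>u\<in>U. W = u +o W"
    using vec.subspace_0[OF U] by (intro bexI[of _ 0]) auto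
  have W_add: "add (quotient_space U W) W (u +o W) = u +o W" for u
    using ops(1)[of 0 u] by simp
  have fld: "Ring.field (field_ring :: 'a ring)"
  proof (rule cring.cring_fieldI2)
    show "cring (field_ring :: 'a ring)"
    proof (rule cringI)
      show "abelian_group (field_ring :: 'a ring)"
        by (rule abelian_groupI) (auto simp: field_ring_def intro: exI[of _ "- x" for x] left_minus)
    qed (auto simp: field_ring_def comm_monoid_def comm_monoid_axioms_def monoid_def algebra_simps)
  next
    fix a :: 'a assume "a \<noteq> \<zero>\<^bsub>field_ring\<^esub>"
    then show "\<exists>b\<in>carrier field_ring. a \<otimes>\<^bsub>field_ring\<^esub> b = \<one>\<^bsub>field_ring\<^esub>"
      by (auto simp: field_ring_def intro!: exI[of _ "inverse a"])
  qed (simp add: field_ring_def)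
  have "abelian_group (quotient_space U W)"
  proof (rule abelian_groupI)
    fix X assume "X \<in> carrier (quotient_space U W)"
    then obtain u where u: "u \<in> U" "X = u +o W"
      by (auto simp: carr)
    show "\<exists>Y\<in>carrier (quotient_space U W). Y \<oplus>\<^bsub>quotient_space U W\<^esub> X = \<zero>\<^bsub>quotient_space U W\<^esub>"
      using u vec.subspace_neg[OF U] by (intro bexI[of _ "(- u) +o W"]) (auto simp: ops carr)
  qed (use vec.subspace_add[OF U] W_carr in \<open>auto simp: carr ops W_add add_ac\<close>)
  moreover have "cring (field_ring :: 'a ring)"
    using fld by (simp add: domain_def field_def)
  ultimately have "Module.module field_ring (quotient_space U W)"
    by (intro module.intro module_axioms.intro)
      (auto simp: carr ops field_ring_def vec.scale_left_distrib vec.scale_right_distrib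
            intro: vec.subspace_scale[OF U])
  then show ?thesis
    using fld by (simp add: vectorspace_def)
qed

definition quotient_dim :: "('a::field^'n) set \<Rightarrow> ('a^'n) set \<Rightarrow> nat" where
  "quotient_dim U W = vectorspace.dim field_ring (quotient_space U W)"

end

theory Submission
  imports Defs
begin

text \<open>
  Without the requirement \<open>g\<^sub>0 \<noteq> 0\<close>, Jordan chains describe the iterates \<open>V\<^sub>0 = {0}\<close>,
  \<open>V\<^sub>k\<^sub>+\<^sub>1 = M\<inverse>(N V\<^sub>k)\<close>, where \<open>(M, N)\<close> is \<open>(A - \<lambda> E, E)\<close> or, at infinity, \<open>(E, A)\<close>. Regularity gives
  \<open>c \<noteq> 0\<close> with \<open>R = M - c N\<close> invertible for both pencils at once, and then \<open>V\<^sub>k\<close> is the kernel of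
  \<open>(R\<inverse> M)\<^sup>k\<close>. A pencil \<open>s F - G\<close> of rank one has a constant column or a constant row as a factor.
  In the first case \<open>R\<inverse> M\<close>, in the second the similar matrix \<open>M R\<inverse>\<close>, is changed
  only by a matrix of rank at most one, so that the old matrix \<open>T\<close> and the new one agree on \<open>ker f\<close> for
  a functional \<open>f\<close>. The largest \<open>T\<close>-invariant subspace \<open>K\<close> of \<open>ker f\<close> is common to both matrices. Modulo
  \<open>K\<close> the matrix \<open>T\<close> is observable through \<open>f\<close>, hence has at most one Jordan block for the eigenvalue 0;
  thus \<open>dim (ker T\<^sup>k\<^sup>+\<^sup>1 / ker T\<^sup>k)\<close> exceeds the same number for the restriction of \<open>T\<close> to \<open>K\<close> by 0 or 1.
\<close>

subsection \<open>Dimension of quotient spaces\<close>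

lemma coset_eq_iff:
  fixes W :: "('a::field^'n) set"
  assumes "vec.subspace W"
  shows "u +o W = v +o W \<longleftrightarrow> u - v \<in> W"
proof
  assume "u +o W = v +o W"
  moreover have "u \<in> u +o W"
    using vec.subspace_0[OF assms] by (force simp: elt_set_plus_def)
  ultimately show "u - v \<in> W"
    by (auto simp: elt_set_plus_def)
next
  have *: "u +o W \<subseteq> v +o W" if "u - v \<in> W" for u v
  proof
    fix x assume "x \<in> u +o W"
    then obtain w where "w \<in> W" "x = u + w"
      by (auto simp: elt_set_plus_def)
    then have "u - v + w \<in> W" "x = v + (u - v + w)"
      using that vec.subspace_add[OF assms] by auto
    then show "x \<in> v +o W"
      unfolding elt_set_plus_def by blast
  qed
  assume "u - v \<in> W"
  with *[of u v] *[of v u] vec.subspace_neg[OF assms] show "u +o W = v +o W"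
    by fastforce
qed

lemma quotient_space_ops:
  fixes W :: "('a::field^'n) set"
  assumes W: "vec.subspace W"
  shows "u +o W \<oplus>\<^bsub>quotient_space U W\<^esub> v +o W = (u + v) +o W"
    and "c \<odot>\<^bsub>quotient_space U W\<^esub> (u +o W) = (c *s u) +o W"
    and "\<zero>\<^bsub>quotient_space U W\<^esub> = 0 +o W"
proof -
  have WW: "w + w' \<in> W" if "w \<in> W" "w' \<in> W" for w w'
    using vec.subspace_add[OF W] that by blast
  have W0: "0 \<in> W"
    by (rule vec.subspace_0[OF W])
  have "W + W = W"
    using WW W0 by (auto simp: set_plus_def) (metis add.right_neutral)
  then show "u +o W \<oplus>\<^bsub>quotient_space U W\<^esub> v +o W = (u + v) +o W"
    by (simp add: quotient_space_def set_plus_rearrange)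
  have "(\<lambda>x. c *s x) ` (u +o W) + W \<subseteq> (c *s u) +o W"
    using WW vec.subspace_scale[OF W]
    by (force simp: elt_set_plus_def set_plus_def vec.scale_right_distrib add.assoc)
  moreover have "c *s u + w \<in> (\<lambda>x. c *s x) ` (u +o W) + W" if "w \<in> W" for w
    using that W0 by (force simp: elt_set_plus_def set_plus_def)
  ultimately show "c \<odot>\<^bsub>quotient_space U W\<^esub> (u +o W) = (c *s u) +o W"
    by (auto simp: quotient_space_def elt_set_plus_def)
qed (simp add: quotient_space_def)

text \<open>A basis \<open>B\<close> of \<open>W\<close> extends to a basis \<open>D\<close> of
  \<open>U\<close>, and the cosets of the added vectors \<open>D - B\<close> form a basis of the
  quotient.\<close>

lemma quotient_dim_eq:
  fixes U W :: "('a::field^'n) set"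
  assumes U: "vec.subspace U" and W: "vec.subspace W" and WU: "W \<subseteq> U"
  shows "quotient_dim U W = vec.dim U - vec.dim W"
proof -
  let ?q = "\<lambda>u. u +o W"
  interpret Q: vectorspace field_ring "quotient_space U W"
    by (rule vectorspace_quotient_space[OF assms])
  note ops = quotient_space_ops[OF W, where U = U]
  have carr: "carrier (quotient_space U W) = ?q ` U"
    by (simp add: quotient_space_def)
  obtain B where B: "B \<subseteq> W" "vec.independent B" "W \<subseteq> vec.span B" "card B = vec.dim W"
    using vec.basis_exists[of W] by auto
  then obtain D where D: "B \<subseteq> D" "D \<subseteq> U" "vec.independent D" "U \<subseteq> vec.span D"
    using vec.maximal_independent_subset_extend[of B U] WU by blast
  define C where "C = D - B"
  have fin: "finite D" "finite C" "finite B"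
    using vec.finiteI_independent[OF D(3)] D(1) by (auto simp: C_def intro: finite_subset)
  have CU: "C \<subseteq> U"
    using D(2) C_def by auto
  have W_span: "W \<subseteq> vec.span (D - {c})" if "c \<in> C" for c
    using B(3) vec.span_mono[of B "D - {c}"] that D(1) unfolding C_def by blast
  \<comment> \<open>Equal cosets of \<open>c\<close> and \<open>d\<close> would put
    \<open>c - d\<close> into \<open>W\<close>, hence into the span of \<open>B\<close>, and
    \<open>c\<close> would depend on \<open>D - {c}\<close>.\<close>
  have inj: "inj_on ?q C"
  proof (rule inj_onI, rule ccontr)
    fix c d assume c: "c \<in> C" "d \<in> C" "?q c = ?q d" "c \<noteq> d"
    have "c - d \<in> vec.span (D - {c})"
      using c W_span coset_eq_iff[OF W] by blast
    moreover have "d \<in> vec.span (D - {c})"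
      using c by (intro vec.span_base) (auto simp: C_def)
    ultimately have "(c - d) + d \<in> vec.span (D - {c})"
      by (rule vec.span_add)
    then show False
      using D(3) c unfolding vec.dependent_def C_def by auto
  qed
  \<comment> \<open>In \<open>Q.lincomb\<close> the coefficients are attached to cosets; injectivity
    of \<open>?q\<close> on \<open>C\<close> lets them be read as coefficients of vectors.\<close>
  have lincomb: "Q.lincomb a (?q ` S) = ?q (\<Sum>c\<in>S. a (?q c) *s c)" if "S \<subseteq> C" for a S
  proof -
    have "finite S"
      using that fin finite_subset by blast
    then show ?thesis
      using that
    proof (induction S)
      case empty
      show ?case
        by (simp add: Q.lincomb_def ops)
    next
      case (insert c S)
      have "?q c \<notin> ?q ` S"
        using insert inj by (auto simp: inj_on_def)
      then have "Q.lincomb a (?q ` insert c S)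
          = a (?q c) \<odot>\<^bsub>quotient_space U W\<^esub> ?q c \<oplus>\<^bsub>quotient_space U W\<^esub> Q.lincomb a (?q ` S)"
        unfolding Q.lincomb_def image_insert
        using insert CU
        by (intro Q.finsum_insert) (auto simp: ops carr intro!: imageI vec.subspace_scale[OF U])
      then show ?case
        using insert by (simp add: ops)
    qed
  qed
  have "Q.lin_indpt (?q ` C)"
  proof
    assume "Q.lin_dep (?q ` C)"
    then obtain A a v where A: "A \<subseteq> ?q ` C" "Q.lincomb a A = \<zero>\<^bsub>quotient_space U W\<^esub>" "v \<in> A" "a v \<noteq> 0"
      unfolding Q.lin_dep_def by (auto simp: field_ring_def)
    then obtain S where S: "S \<subseteq> C" "A = ?q ` S"
      by (meson subset_imageE)
    then obtain c where c: "c \<in> S" "v = ?q c"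
      using A by auto
    have fS: "finite S"
      using S fin finite_subset by blast
    define r where "r d = a (?q d)" for d
    have "(\<Sum>d\<in>S. r d *s d) \<in> W"
      using A(2) S(1) unfolding S(2) r_def lincomb[OF S(1)] ops
      by (subst (asm) coset_eq_iff[OF W]) simp
    then have "(\<Sum>d\<in>S. r d *s d) \<in> vec.span (D - {c})"
      using W_span S c by blast
    moreover have "(\<Sum>d\<in>S - {c}. r d *s d) \<in> vec.span (D - {c})"
      using S by (intro vec.span_sum vec.span_scale vec.span_base) (auto simp: C_def)
    ultimately have "(\<Sum>d\<in>S. r d *s d) - (\<Sum>d\<in>S - {c}. r d *s d) \<in> vec.span (D - {c})"
      by (rule vec.span_diff)
    then have "r c *s c \<in> vec.span (D - {c})"
      by (simp add: sum.remove[OF fS c(1)])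
    from vec.span_scale[OF this, of "inverse (r c)"] have "c \<in> vec.span (D - {c})"
      using A(4) c(2) by (simp add: r_def)
    then show False
      using D(3) S c unfolding vec.dependent_def C_def by blast
  qed
  moreover have "?q ` C \<subseteq> carrier (quotient_space U W)"
    using CU by (auto simp: carr)
  moreover have "Q.gen_set (?q ` C)"
  proof
    show "Q.span (?q ` C) \<subseteq> carrier (quotient_space U W)"
      using calculation(2) by (simp add: Q.span_is_subset2)
    show "carrier (quotient_space U W) \<subseteq> Q.span (?q ` C)"
    proof
      fix X assume "X \<in> carrier (quotient_space U W)"
      then obtain u where u: "u \<in> U" "X = ?q u"
        by (auto simp: carr)
      then obtain r where r: "u = (\<Sum>d\<in>D. r d *s d)"
        using D(4) vec.span_finite[OF fin(1)] by auto
      have "(\<Sum>d\<in>B. r d *s d) \<in> W"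
        using B(1) by (intro vec.subspace_sum[OF W] vec.subspace_scale[OF W]) auto
      moreover have "u = (\<Sum>d\<in>C. r d *s d) + (\<Sum>d\<in>B. r d *s d)"
        unfolding r C_def using D(1) fin by (simp add: sum.subset_diff)
      ultimately have "X = ?q (\<Sum>d\<in>C. r d *s d)"
        using u coset_eq_iff[OF W] by simp
      also have "(\<Sum>d\<in>C. r d *s d) = (\<Sum>d\<in>C. r (the_inv_into C ?q (?q d)) *s d)"
        by (rule sum.cong) (auto simp: the_inv_into_f_f[OF inj])
      also have "?q \<dots> = Q.lincomb (\<lambda>Y. r (the_inv_into C ?q Y)) (?q ` C)"
        by (subst lincomb) auto
      finally show "X \<in> Q.span (?q ` C)"
        unfolding Q.span_def using fin by (auto simp: field_ring_def)
    qed
  qed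
  ultimately have "Q.basis (?q ` C)"
    by (simp add: Q.basis_def)
  then have "Q.dim = card (?q ` C)"
    using fin by (intro Q.dim_basis) auto
  also have "\<dots> = card D - card B"
    using inj fin D(1) by (simp add: card_image C_def card_Diff_subset)
  also have "card D = vec.dim U"
    using D by (intro vec.basis_card_eq_dim) auto
  finally show ?thesis
    by (simp add: quotient_dim_def B(4))
qed

subsection \<open>Pencils of rank one\<close>

lemma minor_2: "minor M 2 \<rho> \<kappa> = M $ \<rho> 0 $ \<kappa> 0 * M $ \<rho> 1 $ \<kappa> 1 - M $ \<rho> 0 $ \<kappa> 1 * M $ \<rho> 1 $ \<kappa> 0"
proof -
  have 2: "{..<2::nat} = insert 0 {1}"
    by auto
  have swap: "{p. p permutes {1::nat}} = {id}"
    by auto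
  show ?thesis
    unfolding minor_def 2
    by (subst sum_over_permutations_insert)
      (simp_all add: swap sign_swap_id swap_id_eq sign_compose permutation_swap_id sign_id)
qed

text \<open>With distinct rows and distinct columns the difference of the two sides is a 2x2 minor,
  which vanishes since 2 exceeds the rank; otherwise the two products coincide.\<close>

lemma pencil_rank_one_minors:
  assumes "pencil_rank F G = 1"
  shows "pencil F G $ i $ j * pencil F G $ i' $ j' = pencil F G $ i $ j' * pencil F G $ i' $ j"
proof (cases "i = i' \<or> j = j'")
  case False
  let ?S = "{r. \<exists>\<rho> \<kappa>. inj_on \<rho> {..<r} \<and> inj_on \<kappa> {..<r} \<and> minor (pencil F G) r \<rho> \<kappa> \<noteq> 0}"
  let ?\<rho> = "\<lambda>n::nat. if n = 0 then i else i'" and ?\<kappa> = "\<lambda>n::nat. if n = 0 then j else j'"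
  \<comment> \<open>\<open>Max\<close> bounds the members only of a finite set; injectivity of the
    row selection limits \<open>r\<close> to the number of rows.\<close>
  have "r \<le> CARD('a)" if "r \<in> ?S" for r
  proof -
    obtain \<rho> :: "nat \<Rightarrow> 'a" where "inj_on \<rho> {..<r}"
      using \<open>r \<in> ?S\<close> by blast
    then show ?thesis
      using card_inj_on_le[of \<rho> "{..<r}" UNIV] by simp
  qed
  then have "finite ?S"
    by (intro finite_subset[of ?S "{..CARD('a)}"]) auto
  then have "2 \<notin> ?S"
    using Max_ge[of ?S 2] assms unfolding pencil_rank_def by linarith
  moreover have "inj_on ?\<rho> {..<2}" "inj_on ?\<kappa> {..<2}"
    using False by (auto simp: inj_on_def)
  ultimately have "minor (pencil F G) 2 ?\<rho> ?\<kappa> = 0"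
    by blast
  then show ?thesis
    by (simp add: minor_2)
qed auto

section \<open>Outer products and the factorization of a pencil of rank one\<close>

definition outer :: "'a::field^'n \<Rightarrow> 'a^'m \<Rightarrow> 'a^'m^'n" where
  "outer v a = (\<chi> i j. v $ i * a $ j)"

definition dot :: "'a::field^'n \<Rightarrow> 'a^'n \<Rightarrow> 'a" where
  "dot a x = (\<Sum>j\<in>UNIV. a $ j * x $ j)"

lemma dot_add: "dot a (x + y) = dot a x + dot a y"
  by (simp add: dot_def distrib_left sum.distrib)

lemma dot_scale: "dot a (c *s x) = c * dot a x"
  by (simp add: dot_def sum_distrib_left mult.left_commute)

lemma outer_mult: "outer v a *v x = dot a x *s v"
  by (simp add: vec_eq_iff outer_def dot_def matrix_vector_mult_def sum_distrib_right
      sum_distrib_left mult_ac)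

text \<open>For the pencil \<open>s F - G\<close> the first alternative splits off the constant
  column \<open>v\<close>, the second the constant row \<open>a\<close>.\<close>

definition common_factor :: "'a::field^'m^'n \<Rightarrow> 'a^'m^'n \<Rightarrow> bool" where
  "common_factor F G \<longleftrightarrow>
     (\<exists>v a b. F = outer v a \<and> G = outer v b) \<or> (\<exists>v w a. F = outer v a \<and> G = outer w a)"

text \<open>A nonzero entry serves as pivot: its column times its row, divided by the pivot,
  reproduces the matrix.\<close>

lemma rank_one_outer:
  fixes X :: "'a::field^'m^'n"
  assumes "\<And>i i' j j'. X $ i $ j * X $ i' $ j' = X $ i $ j' * X $ i' $ j"
  shows "\<exists>u a. X = outer u a"
proof (cases "X = 0")
  case True
  then have "X = outer 0 0"
    by (simp add: outer_def vec_eq_iff)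
  then show ?thesis by blast
next
  case False
  then obtain p q where "X $ p $ q \<noteq> 0"
    by (auto simp: vec_eq_iff)
  then have "X = outer (\<chi> i. X $ i $ q) (\<chi> j. X $ p $ j / X $ p $ q)"
    using assms[of p q] by (simp add: outer_def vec_eq_iff field_simps)
  then show ?thesis by blast
qed

lemma parallel_vectors:
  fixes u w :: "'a::field^'n"
  assumes "\<And>i i'. u $ i * w $ i' = w $ i * u $ i'"
  shows "\<exists>v \<alpha> \<beta>. u = \<alpha> *s v \<and> w = \<beta> *s v"
proof (cases "u = 0")
  case True
  then have "u = 0 *s w \<and> w = 1 *s w"
    by simp
  then show ?thesis by blast
next
  case False
  then obtain p where "u $ p \<noteq> 0"
    by (auto simp: vec_eq_iff)
  then have "u = 1 *s u \<and> w = (w $ p / u $ p) *s u"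
    using assms[of p] by (simp add: vec_eq_iff field_simps)
  then show ?thesis by blast
qed

text \<open>Each vanishing 2x2 minor is a polynomial in \<open>s\<close>. Its leading and constant
  coefficients make \<open>F\<close> and \<open>G\<close> outer products; the middle one forces
  their columns or their rows to be parallel.\<close>

lemma common_factor_pencil_rank_one:
  assumes "pencil_rank F G = 1"
  shows "common_factor F G"
proof -
  have eqs: "F $ i $ j * F $ i' $ j' = F $ i $ j' * F $ i' $ j"
    "G $ i $ j * G $ i' $ j' = G $ i $ j' * G $ i' $ j"
    "F $ i $ j * G $ i' $ j' + G $ i $ j * F $ i' $ j' =
      F $ i $ j' * G $ i' $ j + G $ i $ j' * F $ i' $ j" for i i' j j'
    using pencil_rank_one_minors[OF assms, of i j i' j'] by (simp_all add: pencil_def algebra_simps)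
  obtain u a w b where F: "F = outer u a" and G: "G = outer w b"
    using rank_one_outer[of F] rank_one_outer[of G] eqs by blast
  \<comment> \<open>The middle coefficient splits into a 2x2 minor of the columns \<open>u\<close>,
    \<open>w\<close> times one of the rows \<open>a\<close>, \<open>b\<close>.\<close>
  have prod: "(u $ i * w $ i' - w $ i * u $ i') * (a $ j * b $ j' - b $ j * a $ j') = 0" for i i' j j'
    using eqs(3)[of i j i' j'] by (simp add: F G outer_def algebra_simps)
  \<comment> \<open>Row and column indices in \<open>prod\<close> vary independently, so a single
    nonzero left factor makes all right factors vanish.\<close>
  consider "\<And>i i'. u $ i * w $ i' = w $ i * u $ i'" | "\<And>j j'. a $ j * b $ j' = b $ j * a $ j'"
    using prod by (metis eq_iff_diff_eq_0 mult_eq_0_iff)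
  then show ?thesis
  proof cases
    case 1
    from parallel_vectors[OF this] obtain v \<alpha> \<beta> where "u = \<alpha> *s v" "w = \<beta> *s v"
      by blast
    then have "F = outer v (\<alpha> *s a)" "G = outer v (\<beta> *s b)"
      by (simp_all add: F G outer_def vec_eq_iff)
    then show ?thesis
      unfolding common_factor_def by blast
  next
    case 2
    from parallel_vectors[OF this] obtain v \<alpha> \<beta> where "a = \<alpha> *s v" "b = \<beta> *s v"
      by blast
    then have "F = outer (\<alpha> *s u) v" "G = outer (\<beta> *s w) v"
      by (simp_all add: F G outer_def vec_eq_iff)
    then show ?thesis
      unfolding common_factor_def by blast
  qed
qed

lemma mat_mult_vec: "mat s *v y = s *s y"
  for y :: "'a::field^'n"
  by (simp add: mat_def matrix_vector_mult_def vec_eq_iff if_distrib if_distribR cong: if_cong)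

lemma matrix_mat_mult_vec: "(mat s ** E) *v x = s *s (E *v x)"
  for E :: "'a::field^'n^'n"
  by (simp add: mat_mult_vec flip: matrix_vector_mul_assoc)

text \<open>Adding \<open>F\<close> to \<open>E\<close> and \<open>G\<close> to \<open>A\<close>
  changes the pair \<open>(A - mat l ** E, E)\<close>, which governs chains at \<open>l\<close>, by
  exactly this pair.\<close>

lemma common_factor_shift:
  fixes F G :: "'a::field^'n^'n"
  assumes "common_factor F G"
  shows "common_factor (G - mat l ** F) F"
proof -
  have eq: "mat l ** X = (\<chi> i j. l * X $ i $ j)" for X :: "'a^'n^'n"
    by (simp add: matrix_eq matrix_mat_mult_vec)
      (simp add: matrix_vector_mult_def vec_eq_iff sum_distrib_left mult.assoc)
  have "outer v b - mat l ** outer v a = outer v (b - l *s a)"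
    "outer w a - mat l ** outer v a = outer (w - l *s v) a" for v w a b :: "'a^'n"
    by (simp_all add: eq outer_def vec_eq_iff algebra_simps)
  then show ?thesis
    using assms unfolding common_factor_def by metis
qed

section \<open>Common regular values of two pencils\<close>

lemma poly_det_pencil: "poly (det (pencil E A)) s = det (mat s ** E - A)"
  by (simp add: det_def poly_sum poly_prod poly_pencil)

lemma invertible_iff_ker: "invertible B \<longleftrightarrow> (\<forall>x. B *v x = 0 \<longrightarrow> x = 0)"
  for B :: "'a::field^'n^'n"
  by (simp add: invertible_left_inverse matrix_left_invertible_ker)

text \<open>The two determinants and the linear polynomial with root \<open>l\<close> have a nonzero
  product, which over the complex numbers is nonzero at some point.\<close>

lemma regular_pencils_common_regular_value:
  assumes "regular_pencil E A" "regular_pencil E' A'"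
  obtains s where "s \<noteq> l" "\<And>x. s *s (E *v x) = A *v x \<Longrightarrow> x = 0"
    "\<And>x. s *s (E' *v x) = A' *v x \<Longrightarrow> x = 0"
proof -
  let ?p = "det (pencil E A) * det (pencil E' A') * [:- l, 1:]"
  have "?p \<noteq> 0"
    using assms unfolding regular_pencil_def mult_eq_0_iff by simp
  then obtain s where "poly ?p s \<noteq> 0"
    using poly_all_0_iff_0[of ?p] by blast
  then have "s \<noteq> l" "invertible (mat s ** E - A)" "invertible (mat s ** E' - A')"
    by (auto simp: poly_det_pencil invertible_det_nz)
  then show ?thesis
    using that[of s] unfolding invertible_iff_ker
    by (simp add: matrix_vector_mult_diff_rdistrib matrix_mat_mult_vec)
qed

subsection \<open>Kernels of matrix powers\<close>

lemma
  fixes T :: "'a::field^'n^'n"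
  shows matrix_funpow_0: "((*v) T ^^ k) 0 = 0"
    and matrix_funpow_add: "((*v) T ^^ k) (x + y) = ((*v) T ^^ k) x + ((*v) T ^^ k) y"
    and matrix_funpow_diff: "((*v) T ^^ k) (x - y) = ((*v) T ^^ k) x - ((*v) T ^^ k) y"
    and matrix_funpow_scale: "((*v) T ^^ k) (c *s x) = c *s ((*v) T ^^ k) x"
  by (induction k)
    (simp_all add: matrix_vector_right_distrib matrix_vector_mult_diff_distrib vec.scale)

lemmas matrix_funpow_linear =
  matrix_funpow_0 matrix_funpow_add matrix_funpow_diff matrix_funpow_scale

definition power_kernel :: "'a::field^'n^'n \<Rightarrow> nat \<Rightarrow> ('a^'n) set" where
  "power_kernel T k = {x. ((*v) T ^^ k) x = 0}"

lemma power_kernel_Suc: "x \<in> power_kernel T (Suc k) \<longleftrightarrow> T *v x \<in> power_kernel T k"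
  by (simp add: power_kernel_def funpow_swap1)

lemma subspace_power_kernel: "vec.subspace (power_kernel T k)"
  by (rule vec.subspaceI) (simp_all add: power_kernel_def matrix_funpow_linear)

lemma power_kernel_mono: "power_kernel T k \<subseteq> power_kernel T (Suc k)"
  by (auto simp: power_kernel_def)

lemma power_kernel_funpow:
  assumes "x \<in> power_kernel T (Suc k)" "0 < i"
  shows "((*v) T ^^ i) x \<in> power_kernel T k"
proof -
  have "((*v) T ^^ k) (((*v) T ^^ i) x) = ((*v) T ^^ (k + i)) x"
    by (simp add: funpow_add)
  also have "k + i = (i - 1) + Suc k"
    using assms(2) by simp
  also have "((*v) T ^^ \<dots>) x = ((*v) T ^^ (i - 1)) (((*v) T ^^ Suc k) x)"
    by (simp only: funpow_add comp_apply)
  finally show ?thesis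
    using assms(1) by (simp add: power_kernel_def matrix_funpow_0 del: funpow.simps)
qed

text \<open>For linear \<open>f\<close> this is the kernel of the k-th power of \<open>T\<close>
  restricted to the largest \<open>T\<close>-invariant subspace of ker f.\<close>

definition unobservable_kernel ::
  "('a::field^'n \<Rightarrow> 'a) \<Rightarrow> 'a^'n^'n \<Rightarrow> nat \<Rightarrow> ('a^'n) set" where
  "unobservable_kernel f T k = {x \<in> power_kernel T k. \<forall>i. f (((*v) T ^^ i) x) = 0}"

text \<open>All iterates of an unobservable vector stay where \<open>f\<close> vanishes, so the two
  matrices produce the same orbit.\<close>

lemma unobservable_kernel_cong:
  assumes "\<And>x. f x = 0 \<Longrightarrow> T *v x = T' *v x"
  shows "unobservable_kernel f T k = unobservable_kernel f T' k"
proof -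
  have *: "x \<in> unobservable_kernel f T' k"
    if x: "x \<in> unobservable_kernel f T k" and eq: "\<And>x. f x = 0 \<Longrightarrow> T *v x = T' *v x" for x T T'
  proof -
    have "((*v) T' ^^ i) x = ((*v) T ^^ i) x" for i
      using x eq by (induction i) (auto simp: unobservable_kernel_def)
    then show ?thesis
      using x by (simp add: unobservable_kernel_def power_kernel_def)
  qed
  show ?thesis
    using *[of _ T T'] *[of _ T' T] assms by auto
qed

text \<open>The sum \<open>?S\<close> of ker T^k and the unobservable part of ker T^(k+1) lies in
  ker T^(k+1), which gives the first inequality. One further vector suffices to span ker T^(k+1),
  which gives the second.\<close>

lemma power_kernel_dim_step:
  fixes T :: "'a::field^'n^'n" and f :: "'a^'n \<Rightarrow> 'a"
  assumes f_add: "\<And>x y. f (x + y) = f x + f y" and f_scale: "\<And>c x. f (c *s x) = c * f x"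
  defines "d \<equiv> \<lambda>k. vec.dim (power_kernel T k)"
    and "e \<equiv> \<lambda>k. vec.dim (unobservable_kernel f T k)"
  shows "d k + e (Suc k) \<le> d (Suc k) + e k" and "d (Suc k) + e k \<le> d k + e (Suc k) + 1"
proof -
  let ?W = "power_kernel T k" and ?U = "power_kernel T (Suc k)"
    and ?K = "unobservable_kernel f T (Suc k)"
  let ?S = "{x + y | x y. x \<in> ?W \<and> y \<in> ?K}"
  have f0: "f 0 = 0"
    using f_scale[of 0 0] by simp
  have f_diff: "f (x - y) = f x - f y" for x y
    using f_add[of "x - y" y] by simp
  have "vec.subspace ?K"
    using vec.subspace_0[OF subspace_power_kernel, of T "Suc k"]
      vec.subspace_add[OF subspace_power_kernel, of _ T "Suc k"]
      vec.subspace_scale[OF subspace_power_kernel, of _ T "Suc k"]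
    by (intro vec.subspaceI)
      (simp_all add: unobservable_kernel_def matrix_funpow_linear f0 f_add f_scale)
  from vec.dim_sums_Int[OF subspace_power_kernel this]
  have "vec.dim ?S + vec.dim (?W \<inter> ?K) = d k + e (Suc k)"
    by (simp add: d_def e_def)
  moreover have "?W \<inter> ?K = unobservable_kernel f T k"
    using power_kernel_mono[of T k] by (auto simp: unobservable_kernel_def)
  ultimately have S: "vec.dim ?S + e k = d k + e (Suc k)"
    by (simp add: e_def)
  have SU: "?S \<subseteq> ?U"
    using power_kernel_mono[of T k] vec.subspace_add[OF subspace_power_kernel, of _ T "Suc k"]
    by (fastforce simp: unobservable_kernel_def)
  then have "vec.dim ?S \<le> d (Suc k)"
    unfolding d_def by (rule vec.dim_subset)
  with S show "d k + e (Suc k) \<le> d (Suc k) + e k"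
    by linarith
  have KS: "?K \<subseteq> ?S" and WS: "?W \<subseteq> ?S"
    using vec.subspace_0[OF subspace_power_kernel, of T k] vec.subspace_0[OF \<open>vec.subspace ?K\<close>]
    by force+
  have "\<exists>x. ?U \<subseteq> vec.span (insert x ?S)"
  proof (cases "\<exists>j. \<exists>u\<in>?U. f (((*v) T ^^ j) u) \<noteq> 0")
    case False
    then have "?U \<subseteq> ?K"
      by (auto simp: unobservable_kernel_def)
    then have "?U \<subseteq> vec.span (insert 0 ?S)"
      using KS vec.span_superset[of "insert 0 ?S"] by blast
    then show ?thesis ..
  next
    case True
    define P where "P j \<longleftrightarrow> (\<exists>u\<in>?U. f (((*v) T ^^ j) u) \<noteq> 0)" for j
    \<comment> \<open>\<open>j\<close> is the last time at which \<open>f\<close> sees a vector of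
      \<open>?U\<close>; it exists because T^(k+1) annihilates \<open>?U\<close>.\<close>
    define j where "j = Greatest P"
    have bound: "i \<le> k" if "P i" for i
    proof (rule ccontr)
      assume "\<not> i \<le> k"
      then have i: "i = (i - Suc k) + Suc k"
        by simp
      have "((*v) T ^^ i) u = 0" if "u \<in> ?U" for u
        using that by (subst i)
          (simp only: funpow_add comp_apply power_kernel_def mem_Collect_eq matrix_funpow_0)
      with \<open>P i\<close> show False
        by (simp add: P_def f0)
    qed
    have "P j"
      unfolding j_def using True bound by (metis GreatestI_nat P_def)
    then obtain x where x: "x \<in> ?U" "f (((*v) T ^^ j) x) \<noteq> 0"
      by (auto simp: P_def)
    have above_j: "f (((*v) T ^^ i) u) = 0" if "j < i" "u \<in> ?U" for i u
      using Greatest_le_nat[of P i k] bound that unfolding P_def j_def by fastforce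
    have shift: "((*v) T ^^ m) x \<in> vec.span (insert x ?S)" for m
      using power_kernel_funpow[OF x(1), of m] WS by (cases "m = 0") (auto intro: vec.span_base)
    \<comment> \<open>Vectors \<open>T\<^sup>m x\<close> with \<open>m > 0\<close> lie in \<open>ker T\<^sup>k\<close> and cancel the values \<open>f (T\<^sup>i z)\<close> one by
      one, from \<open>i = j\<close> downwards; only the first cancellation uses \<open>x\<close> itself.\<close>
    have approx: "\<exists>y. y \<in> ?U \<and> y \<in> vec.span (insert x ?S) \<and>
        (\<forall>i. j < i + m \<longrightarrow> f (((*v) T ^^ i) (z - y)) = 0)" if z: "z \<in> ?U" and "m \<le> Suc j" for z m
      using \<open>m \<le> Suc j\<close>
    proof (induction m)
      case 0
      show ?case
        using z above_j vec.subspace_0[OF subspace_power_kernel, of T "Suc k"]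
        by (intro exI[of _ 0]) (simp add: vec.span_zero)
    next
      case (Suc m)
      then obtain y where y: "y \<in> ?U" "y \<in> vec.span (insert x ?S)"
        "\<And>i. j < i + m \<Longrightarrow> f (((*v) T ^^ i) (z - y)) = 0"
        by auto
      let ?x = "((*v) T ^^ m) x"
      \<comment> \<open>\<open>c\<close> cancels the value at \<open>i = j - m\<close>. For larger
        \<open>i\<close> the orbit of \<open>x\<close> is past time \<open>j\<close>, so the zeros
        already reached persist.\<close>
      define c where "c = f (((*v) T ^^ (j - m)) (z - y)) / f (((*v) T ^^ j) x)"
      have "?x \<in> ?U"
        using power_kernel_funpow[OF x(1), of m] x(1) power_kernel_mono[of T k]
        by (cases "m = 0") auto
      then have "y + c *s ?x \<in> ?U"
        using y(1) by (intro vec.subspace_add[OF subspace_power_kernel]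
            vec.subspace_scale[OF subspace_power_kernel])
      moreover have "y + c *s ?x \<in> vec.span (insert x ?S)"
        using y(2) shift by (intro vec.span_add vec.span_scale)
      moreover have "f (((*v) T ^^ i) (z - (y + c *s ?x))) = 0" if "j < i + Suc m" for i
      proof -
        have "((*v) T ^^ i) (z - (y + c *s ?x)) =
            ((*v) T ^^ i) (z - y) - c *s ((*v) T ^^ (i + m)) x"
          by (simp add: matrix_funpow_linear funpow_add algebra_simps)
        then have f_eq: "f (((*v) T ^^ i) (z - (y + c *s ?x))) =
            f (((*v) T ^^ i) (z - y)) - c * f (((*v) T ^^ (i + m)) x)"
          by (simp add: f_diff f_scale)
        consider "j < i + m" | "i + m = j" "i = j - m"
          using \<open>j < i + Suc m\<close> by linarith
        then show ?thesis
          unfolding f_eq using x y(3) above_j[of "i + m" x] by cases (simp_all add: c_def)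
      qed
      ultimately show ?case by blast
    qed
    have "z \<in> vec.span (insert x ?S)" if "z \<in> ?U" for z
    proof -
      \<comment> \<open>For \<open>m = Suc j\<close> the condition \<open>j < i + m\<close> holds
        for every \<open>i\<close>, so \<open>z - y\<close> is unobservable.\<close>
      obtain y where y: "y \<in> ?U" "y \<in> vec.span (insert x ?S)"
        "\<And>i. f (((*v) T ^^ i) (z - y)) = 0"
        using approx[OF \<open>z \<in> ?U\<close>, of "Suc j"] by auto
      then have "z - y \<in> ?K"
        using that vec.subspace_diff[OF subspace_power_kernel]
        by (auto simp: unobservable_kernel_def)
      then have "z - y \<in> vec.span (insert x ?S)"
        using KS by (intro vec.span_base) blast
      from vec.span_add[OF this y(2)] show ?thesis by simp
    qed
    then show ?thesis by blast
  qed
  then obtain x where "?U \<subseteq> vec.span (insert x ?S)" ..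
  then have "d (Suc k) \<le> vec.dim (insert x ?S)"
    unfolding d_def by (rule vec.subset_le_dim)
  also have "\<dots> \<le> vec.dim ?S + 1"
    by (simp add: vec.dim_insert)
  finally show "d (Suc k) + e k \<le> d k + e (Suc k) + 1"
    using S by linarith
qed

text \<open>Both increments exceed the increment of the common unobservable kernels by 0 or
  1.\<close>

lemma power_kernel_dim_perturbation:
  fixes T T' :: "'a::field^'n^'n" and f :: "'a^'n \<Rightarrow> 'a"
  assumes f: "\<And>x y. f (x + y) = f x + f y" "\<And>c x. f (c *s x) = c * f x"
    and eq: "\<And>x. f x = 0 \<Longrightarrow> T *v x = T' *v x"
  shows "\<bar>(int (vec.dim (power_kernel T' (Suc k))) - int (vec.dim (power_kernel T' k))) -
          (int (vec.dim (power_kernel T (Suc k))) - int (vec.dim (power_kernel T k)))\<bar> \<le> 1"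
proof -
  have "unobservable_kernel f T' m = unobservable_kernel f T m" for m
    by (rule unobservable_kernel_cong) (simp add: eq)
  then show ?thesis
    using power_kernel_dim_step[OF f, of T k] power_kernel_dim_step[OF f, of T' k] by simp
qed

subsection \<open>Jordan chains\<close>

primrec chain_space :: "'a::field^'n^'n \<Rightarrow> 'a^'n^'n \<Rightarrow> nat \<Rightarrow> ('a^'n) set" where
  "chain_space M N 0 = {0}"
| "chain_space M N (Suc k) = {x. \<exists>y\<in>chain_space M N k. M *v x = N *v y}"

lemma zero_in_chain_space: "0 \<in> chain_space M N k"
  by (induction k) (auto intro!: bexI[of _ 0])

lemma chain_space_mono: "k \<le> l \<Longrightarrow> chain_space M N k \<subseteq> chain_space M N l"
proof (rule lift_Suc_mono_le[of "chain_space M N"])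
  fix k
  show "chain_space M N k \<subseteq> chain_space M N (Suc k)"
  proof (induction k)
    case (Suc k)
    then show ?case
      by (subst (1 2) chain_space.simps) blast
  qed simp
qed

definition is_chain :: "'a::field^'n^'n \<Rightarrow> 'a^'n^'n \<Rightarrow> nat \<Rightarrow> (nat \<Rightarrow> 'a^'n) \<Rightarrow> bool" where
  "is_chain M N m g \<longleftrightarrow> 0 < m \<and> g 0 \<noteq> 0 \<and> M *v g 0 = 0 \<and>
     (\<forall>j. 1 \<le> j \<and> j < m \<longrightarrow> M *v g j = N *v g (j - 1))"

text \<open>Tracing an element of \<open>chain_space M N k\<close> back may run into zero early;
  dropping these leading zeros leaves a genuine chain, possibly shorter than
  \<open>k\<close>.\<close>

lemma chain_space_eq_chains:
  "chain_space M N k = {0} \<union> {g j | g j. j < k \<and> is_chain M N (j + 1) g}"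
proof (intro equalityI subsetI)
  fix x assume "x \<in> chain_space M N k"
  then show "x \<in> {0} \<union> {g j | g j. j < k \<and> is_chain M N (j + 1) g}"
  proof (induction k arbitrary: x)
    case (Suc k)
    then obtain y where y: "y \<in> chain_space M N k" "M *v x = N *v y"
      by auto
    \<comment> \<open>A nonzero \<open>x\<close> either starts a chain, when \<open>y = 0\<close>,
      or prolongs the chain that ends in \<open>y\<close>.\<close>
    consider "x = 0" | "x \<noteq> 0" "y = 0" | g j where "y = g j" "j < k" "is_chain M N (j + 1) g"
      using Suc.IH[OF y(1)] by auto
    then show ?case
    proof cases
      case 2
      then have "is_chain M N (0 + 1) (\<lambda>_. x)"
        using y by (simp add: is_chain_def)
      then show ?thesis by force
    next
      case 3
      let ?g = "g(Suc j := x)"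
      have "is_chain M N (Suc j + 1) ?g"
        using 3 y unfolding is_chain_def by (auto simp: less_Suc_eq)
      moreover have "x = ?g (Suc j)" "Suc j < Suc k"
        using 3 by simp_all
      ultimately show ?thesis by blast
    qed simp
  qed simp
next
  fix x assume "x \<in> {0} \<union> {g j | g j. j < k \<and> is_chain M N (j + 1) g}"
  then consider "x = 0" | g j where "x = g j" "j < k" "is_chain M N (j + 1) g"
    by auto
  then show "x \<in> chain_space M N k"
  proof cases
    case 2
    have "g i \<in> chain_space M N (Suc i)" if "i \<le> j" for i
      using that
    proof (induction i)
      case 0
      then show ?case
        using 2 by (simp add: is_chain_def)
    next
      case (Suc i)
      then have "M *v g (Suc i) = N *v g i"
        using 2 by (simp add: is_chain_def)
      then show ?case
        using Suc by (subst chain_space.simps) auto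
    qed
    then show ?thesis
      using 2 chain_space_mono[of "Suc j" k M N] by auto
  qed (simp add: zero_in_chain_space)
qed

lemma jordan_space_eq_chain_space:
  "jordan_space E A (Finite l) k = chain_space (A - mat l ** E) E k"
  "jordan_space E A Infinity k = chain_space E A k"
  by (simp_all add: jordan_space_def chain_space_eq_chains is_chain_def)

text \<open>\<open>T\<close> is nilpotent on this kernel, so the Neumann sum z + T z + T^2 z + ...
  is finite; the induction builds it.\<close>

lemma power_kernel_surj_id_minus:
  fixes T :: "'a::field^'n^'n"
  assumes "z \<in> power_kernel T k"
  shows "\<exists>y\<in>power_kernel T k. y - T *v y = z"
  using assms
proof (induction k arbitrary: z)
  case (Suc k)
  then obtain y where "y \<in> power_kernel T k" "y - T *v y = T *v z"
    by (auto simp: power_kernel_Suc)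
  moreover from this have "z + y \<in> power_kernel T (Suc k)"
    using Suc.prems power_kernel_mono[of T k] vec.subspace_add[OF subspace_power_kernel] by blast
  ultimately show ?case
    by (intro bexI[of _ "z + y"]) (simp_all add: matrix_vector_right_distrib algebra_simps)
qed (simp add: power_kernel_def)

text \<open>With T = S M, the choice of \<open>S\<close> gives c S N = T - 1, so M x = N y reads c T
  x = (T - 1) y. Since T - 1 maps ker T^k onto itself, such a \<open>y\<close> in ker T^k exists
  exactly if T x lies in ker T^k.\<close>

lemma chain_space_eq_power_kernel:
  fixes M N S :: "'a::field^'n^'n"
  assumes "c \<noteq> 0" and SR: "S ** (M - mat c ** N) = mat 1" and RS: "(M - mat c ** N) ** S = mat 1"
  shows "chain_space M N k = power_kernel (S ** M) k"
proof (induction k)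
  case 0
  show ?case by (simp add: power_kernel_def)
next
  case (Suc k)
  let ?T = "S ** M"
  have TN: "c *s (S *v (N *v y)) = ?T *v y - y" for y
  proof -
    have "y = S *v ((M - mat c ** N) *v y)"
      by (simp add: matrix_vector_mul_assoc SR)
    also have "\<dots> = ?T *v y - c *s (S *v (N *v y))"
      by (simp add: matrix_vector_mult_diff_rdistrib matrix_vector_mult_diff_distrib
          mat_mult_vec vec.scale flip: matrix_vector_mul_assoc)
    finally show ?thesis
      by (simp add: algebra_simps)
  qed
  have inj: "M *v x = N *v y \<longleftrightarrow> ?T *v x = S *v (N *v y)" for x y
    by (metis RS matrix_vector_mul_assoc matrix_vector_mul_lid)
  have "x \<in> chain_space M N (Suc k) \<longleftrightarrow> x \<in> power_kernel ?T (Suc k)" for x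
  proof
    assume "x \<in> chain_space M N (Suc k)"
    then obtain y where y: "y \<in> power_kernel ?T k" "?T *v x = S *v (N *v y)"
      by (auto simp: Suc.IH inj)
    then have "c *s (?T *v x) = ?T *v y - y"
      by (simp add: TN)
    moreover have "?T *v y \<in> power_kernel ?T k"
      using y(1) power_kernel_mono power_kernel_Suc by blast
    ultimately have "c *s (?T *v x) \<in> power_kernel ?T k"
      using y(1) by (simp add: vec.subspace_diff[OF subspace_power_kernel])
    then have "inverse c *s (c *s (?T *v x)) \<in> power_kernel ?T k"
      by (rule vec.subspace_scale[OF subspace_power_kernel])
    then show "x \<in> power_kernel ?T (Suc k)"
      using \<open>c \<noteq> 0\<close> by (simp add: power_kernel_Suc)
  next
    assume "x \<in> power_kernel ?T (Suc k)"
    then obtain y where y: "y \<in> power_kernel ?T k" "y - ?T *v y = ?T *v x"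
      using power_kernel_surj_id_minus power_kernel_Suc by blast
    \<comment> \<open>The predecessor of \<open>x\<close> is \<open>(- c) *s y\<close>: the sign
      turns T y - y into y - T y, and the factor \<open>c\<close> then cancels.\<close>
    have "c *s (S *v (N *v ((- c) *s y))) = ?T *v ((- c) *s y) - ((- c) *s y)"
      by (rule TN)
    also have "\<dots> = c *s (y - ?T *v y)"
      by (simp only: vec.scale vec.scale_right_diff_distrib) (simp add: vec.scale_minus_left)
    finally have "S *v (N *v ((- c) *s y)) = ?T *v x"
      using \<open>c \<noteq> 0\<close> y(2) by (metis vec.scale_left_imp_eq)
    moreover have "(- c) *s y \<in> power_kernel ?T k"
      by (rule vec.subspace_scale[OF subspace_power_kernel y(1)])
    ultimately show "x \<in> chain_space M N (Suc k)"
      unfolding chain_space.simps Suc.IH mem_Collect_eq inj by metis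
  qed
  then show ?case by blast
qed

text \<open>M S = R (S M) S with \<open>S\<close> inverse to \<open>R\<close>, so \<open>R\<close>
  maps one kernel bijectively onto the other.\<close>

lemma dim_power_kernel_similar:
  fixes M R S :: "'a::field^'n^'n"
  assumes SR: "S ** R = mat 1" and RS: "R ** S = mat 1"
  shows "vec.dim (power_kernel (M ** S) k) = vec.dim (power_kernel (S ** M) k)"
proof -
  have S_R: "S *v (R *v x) = x" and R_S: "R *v (S *v x) = x" for x
    by (simp_all add: matrix_vector_mul_assoc SR RS)
  have conj: "R *v (((*v) (S ** M) ^^ k) x) = ((*v) (M ** S) ^^ k) (R *v x)" for x
    by (induction k) (simp_all add: S_R R_S flip: matrix_vector_mul_assoc, metis S_R R_S)
  have "inj ((*v) R)"
    using S_R by (rule inj_on_inverseI)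
  have "((*v) R) ` power_kernel (S ** M) k = power_kernel (M ** S) k"
  proof (intro equalityI subsetI)
    fix y assume "y \<in> power_kernel (M ** S) k"
    then have "S *v y \<in> power_kernel (S ** M) k"
      using conj[of "S *v y"] S_R by (simp add: power_kernel_def R_S) (metis S_R vec.zero)
    then show "y \<in> ((*v) R) ` power_kernel (S ** M) k"
      by (metis R_S imageI)
  qed (auto simp: power_kernel_def simp flip: conj)
  then show ?thesis
    using vec.dim_image_eq[OF matrix_vector_mul_linear_gen inj_on_subset[OF \<open>inj ((*v) R)\<close>]]
    by (metis subset_UNIV)
qed

subsection \<open>Perturbation of the pencil\<close>

lemma chain_space_dim_perturbation:
  fixes M N M' N' :: "'a::field^'n^'n"
  assumes "c \<noteq> 0" and "invertible (M - mat c ** N)" and "invertible (M' - mat c ** N')"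
    and "common_factor (M' - M) (N' - N)"
  shows "\<bar>(int (vec.dim (chain_space M' N' (Suc k))) - int (vec.dim (chain_space M' N' k))) -
          (int (vec.dim (chain_space M N (Suc k))) - int (vec.dim (chain_space M N k)))\<bar> \<le> 1"
proof -
  let ?R = "M - mat c ** N" and ?R' = "M' - mat c ** N'"
  obtain S where S: "?R ** S = mat 1" "S ** ?R = mat 1"
    using assms(2) invertible_def by blast
  obtain S' where S': "?R' ** S' = mat 1" "S' ** ?R' = mat 1"
    using assms(3) invertible_def by blast
  note space = chain_space_eq_power_kernel[OF assms(1) S(2,1)]
    and space' = chain_space_eq_power_kernel[OF assms(1) S'(2,1)]
  have R: "?R *v x = M *v x - c *s (N *v x)" and R': "?R' *v x = M' *v x - c *s (N' *v x)" for x
    by (simp_all add: matrix_vector_mult_diff_rdistrib matrix_mat_mult_vec)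
  have M': "M' *v x = M *v x + (M' - M) *v x" and N': "N' *v x = N *v x + (N' - N) *v x" for x
    by (simp_all add: matrix_vector_mult_diff_rdistrib)
  consider v a b where "M' - M = outer v a" "N' - N = outer v b"
    | v w a where "M' - M = outer v a" "N' - N = outer w a"
    using assms(4) unfolding common_factor_def by blast
  then show ?thesis
  proof cases
    case (1 v a b)
    let ?T = "S ** M" and ?T' = "S' ** M'"
    \<comment> \<open>For y = T x, passing from \<open>?R\<close> to \<open>?R'\<close> adds
      \<open>dot a y - c * dot b y\<close> times \<open>v\<close> to R y = M x, and M' x adds
      \<open>dot a x\<close> times \<open>v\<close>. If \<open>f x = 0\<close>, these agree, so R' y
      = M' x and y = T' x.\<close>
    define f where "f x = dot a x - (dot a (?T *v x) - c * dot b (?T *v x))" for x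
    have "?T *v x = ?T' *v x" if "f x = 0" for x
    proof -
      have "?R' *v y = ?R *v y + (dot a y - c * dot b y) *s v" for y
        unfolding R R' M'[of y] N'[of y] 1 outer_mult
        by (simp add: vec_eq_iff algebra_simps)
      then have "?R' *v (?T *v x) = ?R *v (?T *v x) + dot a x *s v"
        using that by (simp add: f_def)
      also have "?R *v (?T *v x) = M *v x"
        using S(1) by (simp add: matrix_vector_mul_assoc matrix_mul_assoc)
      finally have "?R' *v (?T *v x) = M' *v x"
        by (simp add: M'[of x] 1 outer_mult)
      then have "S' *v (?R' *v (?T *v x)) = ?T' *v x"
        by (simp add: matrix_vector_mul_assoc)
      then show ?thesis
        using S'(2) by (simp add: matrix_vector_mul_assoc matrix_mul_assoc)
    qed
    moreover have "f (x + y) = f x + f y" "f (r *s x) = r * f x" for x y r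
      by (simp_all add: f_def dot_add dot_scale matrix_vector_right_distrib vec.scale algebra_simps)
    ultimately show ?thesis
      unfolding space space' by (intro power_kernel_dim_perturbation[of f])
  next
    case (2 v w a)
    \<comment> \<open>If \<open>f z = 0\<close>, both perturbations vanish at y = S z. Then R' y = R
      y = z, so S' z = y, and M' y = M y. This compares \<open>M ** S\<close> with
      \<open>M' ** S'\<close>, whence the passage to similar matrices below.\<close>
    define f where "f z = dot a (S *v z)" for z
    have "(M ** S) *v z = (M' ** S') *v z" if "f z = 0" for z
    proof -
      let ?y = "S *v z"
      have y: "M' *v ?y = M *v ?y" "N' *v ?y = N *v ?y"
        using that unfolding M'[of ?y] N'[of ?y] 2 outer_mult by (simp_all add: f_def)
      then have "?R' *v ?y = z"
        using S(1) R R' by (metis matrix_vector_mul_assoc matrix_vector_mul_lid)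
      then have "S' *v z = ?y"
        using S'(2) by (metis matrix_vector_mul_assoc matrix_vector_mul_lid)
      then show ?thesis
        using y(1) by (simp flip: matrix_vector_mul_assoc)
    qed
    moreover have "f (x + y) = f x + f y" "f (r *s x) = r * f x" for x y r
      by (simp_all add: f_def dot_add dot_scale matrix_vector_right_distrib vec.scale)
    ultimately show ?thesis
      unfolding space space' dim_power_kernel_similar[OF S(2,1), symmetric]
        dim_power_kernel_similar[OF S'(2,1), symmetric]
      by (intro power_kernel_dim_perturbation[of f])
  qed
qed

lemma subspace_chain_space: "vec.subspace (chain_space M N k)"
proof (induction k)
  case (Suc k)
  show ?case
  proof (rule vec.subspaceI)
    fix x y assume "x \<in> chain_space M N (Suc k)" "y \<in> chain_space M N (Suc k)"
    then obtain x' y' where "x' \<in> chain_space M N k" "M *v x = N *v x'"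
      "y' \<in> chain_space M N k" "M *v y = N *v y'"
      by auto
    then show "x + y \<in> chain_space M N (Suc k)"
      using vec.subspace_add[OF Suc]
      by (auto simp: matrix_vector_right_distrib intro!: bexI[of _ "x' + y'"])
  next
    fix c x assume "x \<in> chain_space M N (Suc k)"
    then obtain x' where "x' \<in> chain_space M N k" "M *v x = N *v x'"
      by auto
    then show "c *s x \<in> chain_space M N (Suc k)"
      using vec.subspace_scale[OF Suc] by (auto simp: vec.scale intro!: bexI[of _ "c *s x'"])
  qed (rule zero_in_chain_space)
qed simp

theorem proposition4p2:
  fixes E A F G :: "complex^'n^'n" and \<mu> :: extended_complex and k :: nat
  assumes "regular_pencil E A"
    and "pencil_rank F G = 1"
    and "regular_pencil (E + F) (A + G)"
    and "k \<ge> 1"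
  shows "\<bar>int (quotient_dim (jordan_space (E + F) (A + G) \<mu> (k + 1))
                            (jordan_space (E + F) (A + G) \<mu> k)) -
          int (quotient_dim (jordan_space E A \<mu> (k + 1)) (jordan_space E A \<mu> k))\<bar> \<le> 1 \<and>
         \<bar>int (vec.dim (jordan_space (E + F) (A + G) \<mu> k)) -
          int (vec.dim (jordan_space E A \<mu> k))\<bar> \<le> int k"
proof -
  have cf: "common_factor F G"
    using assms(2) by (rule common_factor_pencil_rank_one)
  \<comment> \<open>\<open>(M, N)\<close> is \<open>(A - mat l ** E, E)\<close> at a finite
    \<open>l\<close> and \<open>(E, A)\<close> at infinity; afterwards both cases run alike.\<close>
  obtain M N M' N' c where space: "\<And>l. jordan_space E A \<mu> l = chain_space M N l"
      "\<And>l. jordan_space (E + F) (A + G) \<mu> l = chain_space M' N' l"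
    and c: "c \<noteq> 0" "invertible (M - mat c ** N)" "invertible (M' - mat c ** N')"
      "common_factor (M' - M) (N' - N)"
  proof (cases \<mu>)
    case (Finite l)
    obtain s where s: "s \<noteq> l" "\<And>x. s *s (E *v x) = A *v x \<Longrightarrow> x = 0"
      "\<And>x. s *s ((E + F) *v x) = (A + G) *v x \<Longrightarrow> x = 0"
      using regular_pencils_common_regular_value[OF assms(1,3)] by metis
    show ?thesis
    proof (rule that)
      \<comment> \<open>The shift \<open>c = s - l\<close> turns \<open>A - mat l ** E\<close> into
        A - s E, which is invertible at the regular value \<open>s\<close>.\<close>
      show "invertible (A - mat l ** E - mat (s - l) ** E)"
        "invertible (A + G - mat l ** (E + F) - mat (s - l) ** (E + F))"
        using s(2,3)
        by (simp_all add: invertible_iff_ker matrix_vector_mult_diff_rdistrib matrix_mat_mult_vec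
            vec.scale_left_diff_distrib del: matrix_vector_mult_add_rdistrib)
      have "A + G - mat l ** (E + F) - (A - mat l ** E) = G - mat l ** F"
        by (simp add: matrix_add_ldistrib)
      then show "common_factor (A + G - mat l ** (E + F) - (A - mat l ** E)) (E + F - E)"
        using common_factor_shift[OF cf] by simp
    qed (simp_all add: Finite jordan_space_eq_chain_space s(1))
  next
    case Infinity
    obtain s where s: "s \<noteq> 0" "\<And>x. s *s (E *v x) = A *v x \<Longrightarrow> x = 0"
      "\<And>x. s *s ((E + F) *v x) = (A + G) *v x \<Longrightarrow> x = 0"
      using regular_pencils_common_regular_value[OF assms(1,3)] by metis
    \<comment> \<open>At infinity \<open>c = 1 / s\<close>, because E - (1/s) A is s E - A up to the
      factor 1/s.\<close>
    have inv: "invertible (B - mat (1 / s) ** C)"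
      if "\<And>x. s *s (B *v x) = C *v x \<Longrightarrow> x = 0" for B C :: "complex^'n^'n"
      unfolding invertible_iff_ker
    proof (intro allI impI)
      fix x assume "(B - mat (1 / s) ** C) *v x = 0"
      then have "B *v x = (1 / s) *s (C *v x)"
        by (simp add: matrix_vector_mult_diff_rdistrib matrix_mat_mult_vec)
      then have "s *s (B *v x) = C *v x"
        using s(1) by simp
      then show "x = 0" by (rule that)
    qed
    show ?thesis
    proof (rule that)
      show "invertible (E - mat (1 / s) ** A)" "invertible (E + F - mat (1 / s) ** (A + G))"
        by (rule inv, erule s(2)) (rule inv, erule s(3))
    qed (simp_all add: Infinity jordan_space_eq_chain_space s(1) cf)
  qed
  let ?d = "\<lambda>l. int (vec.dim (chain_space M N l))"
  let ?d' = "\<lambda>l. int (vec.dim (chain_space M' N' l))"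
  have step: "\<bar>(?d' (Suc l) - ?d' l) - (?d (Suc l) - ?d l)\<bar> \<le> 1" for l
    using c by (rule chain_space_dim_perturbation)
  \<comment> \<open>The difference in \<open>quotient_dim_eq\<close> is truncated; monotonicity of
    the dimension makes it an integer difference.\<close>
  have quotient: "int (quotient_dim (chain_space B C (k + 1)) (chain_space B C k)) =
      int (vec.dim (chain_space B C (Suc k))) - int (vec.dim (chain_space B C k))"
    for B C :: "complex^'n^'n"
  proof -
    have "chain_space B C k \<subseteq> chain_space B C (Suc k)"
      by (rule chain_space_mono) simp
    then show ?thesis
      using vec.dim_subset[of "chain_space B C k" "chain_space B C (Suc k)"]
      by (simp add: quotient_dim_eq subspace_chain_space of_nat_diff del: chain_space.simps)
  qed
  \<comment> \<open>Both sequences start with the zero space, and each step widens the gap by at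
    most 1.\<close>
  have "\<bar>?d' l - ?d l\<bar> \<le> int l" for l
  proof (induction l)
    case (Suc l)
    then show ?case
      using step[of l] by (simp del: chain_space.simps)
  qed simp
  then show ?thesis
    unfolding space quotient using step[of k] by simp
qed

end
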